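(* Let $G=(V\cup B,E)$ be a connected graph with boundary vertices $B$ and interior vertices $V$, $|V|=n$. Given an initial profile $f_0:V\cup B\to[0,1]$, let $h$ denote the infinity harmonic extension of $f_0|_B$ from $B$ to $V$, and run the Lipschitz learning dynamics with boundary values $f_0|_B$, where the update vertices $\{v_t\}$ are chosen from $V$ in round robin fashion. Then for all integers $t\ge 0$, $$\|f_t-h\|_1\le n\exp\Bigl(\frac{-\lfloor t/n\rfloor}{2n^2}\Bigr).$$ Thus, for all $0<\epsilon<1$, $$\tau^*(\epsilon)\le n+2n^3\log\frac{n}{\epsilon}.$$
   Context: All graphs are finite, undirected and simple. The vertex set of $G$ is the disjoint union of nonempty sets $B$ (boundary) and $V$ (interior), and there are no edges between vertices of $B$. Lipschitz learning with prescribed boundary values: given $f_0$ and update vertices $v_1,v_2,\ldots\in V$, for $t\ge 1$ set $f_t(v_t)=\frac12\bigl(\max_{u\sim v_t}f_{t-1}(u)+\min_{w\sim v_t}f_{t-1}(w)\bigr)$ and $f_t(v)=f_{t-1}(v)$ for $v\ne v_t$; boundary vertices are never updated. Round robin means that vertices are selected according to a fixed cyclic permutation of $V$: $v_1,\dots,v_n$ is an enumeration of $V$ and $v_{t+n}=v_t$ for all $t\ge 1$. A function $h:V\cup B\to\mathbb{R}$ is infinity harmonic on $V$ if $h(v)=\frac12(\max_{u\sim v}h(u)+\min_{w\sim v}h(w))$ for all $v\in V$; it is known that any boundary data on $B$ has a unique extension to $V\cup B$ that is infinity harmonic on $V$ (the infinity harmonic extension). $\|\cdot\|_1$ and $\|\cdot\|_\infty$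 are the $\ell^1$ and sup norms over vertices. $\tau^*(\epsilon)=\min\{t\ge 0:\ \|f_t-h\|_\infty\le\epsilon\}$. *)

theory Defs
  imports
    Complex_Main
    "HOL-Library.Extended_Real"
    "Graph_Theory.Graph_Theory"
begin

text \<open>
  A finite undirected simple graph is a \<^const>\<open>pair_graph\<close>: an undirected edge between \<open>u\<close> and \<open>w\<close>
  is present as both arcs \<open>(u, w)\<close> and \<open>(w, u)\<close>. The boundary part \<open>B\<close> and the interior part \<open>V\<close>
  are passed explicitly. Functions on the vertex set are functions on the whole type; their
  values off the vertex set never matter.
\<close>

definition graph_with_boundary :: "'a pair_pre_digraph \<Rightarrow> 'a set \<Rightarrow> 'a set \<Rightarrow> bool" where
  "graph_with_boundary G B V \<longleftrightarrow>
     pair_graph G \<and> Digraph_Component.connected (with_proj G) \<and>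
     pverts G = V \<union> B \<and> V \<inter> B = {} \<and> V \<noteq> {} \<and> B \<noteq> {} \<and>
     (\<forall>u\<in>B. \<forall>w\<in>B. (u, w) \<notin> parcs G)"

definition nbrs :: "'a pair_pre_digraph \<Rightarrow> 'a \<Rightarrow> 'a set" where
  "nbrs G v = {u. (v, u) \<in> parcs G}"

text \<open>
  In a connected graph with at least two vertices the maximum and minimum below range over
  finite nonempty sets.
\<close>

definition midrange :: "'a pair_pre_digraph \<Rightarrow> ('a \<Rightarrow> real) \<Rightarrow> 'a \<Rightarrow> real" where
  "midrange G f v = (Max (f ` nbrs G v) + Min (f ` nbrs G v)) / 2"

definition infinity_harmonic_on ::
    "'a pair_pre_digraph \<Rightarrow> 'a set \<Rightarrow> ('a \<Rightarrow> real) \<Rightarrow> bool" where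
  "infinity_harmonic_on G V h \<longleftrightarrow> (\<forall>v\<in>V. h v = midrange G h v)"

definition infinity_harmonic_extension ::
    "'a pair_pre_digraph \<Rightarrow> 'a set \<Rightarrow> 'a set \<Rightarrow> ('a \<Rightarrow> real) \<Rightarrow> ('a \<Rightarrow> real) \<Rightarrow> bool" where
  "infinity_harmonic_extension G B V g h \<longleftrightarrow>
     (\<forall>b\<in>B. h b = g b) \<and> infinity_harmonic_on G V h"

text \<open>The update vertices are \<open>v 1, v 2, \<dots>\<close>; the value \<open>v 0\<close> is not used.\<close>

primrec lipschitz_learning ::
    "'a pair_pre_digraph \<Rightarrow> (nat \<Rightarrow> 'a) \<Rightarrow> ('a \<Rightarrow> real) \<Rightarrow> nat \<Rightarrow> ('a \<Rightarrow> real)" where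
  "lipschitz_learning G v f0 0 = f0"
| "lipschitz_learning G v f0 (Suc t) =
     (lipschitz_learning G v f0 t)
       (v (Suc t) := midrange G (lipschitz_learning G v f0 t) (v (Suc t)))"

definition round_robin :: "'a set \<Rightarrow> (nat \<Rightarrow> 'a) \<Rightarrow> bool" where
  "round_robin V v \<longleftrightarrow>
     bij_betw v {1..card V} V \<and> (\<forall>t\<ge>1. v (t + card V) = v t)"

definition l1_norm :: "'a pair_pre_digraph \<Rightarrow> ('a \<Rightarrow> real) \<Rightarrow> real" where
  "l1_norm G f = (\<Sum>x\<in>pverts G. \<bar>f x\<bar>)"

definition sup_norm :: "'a pair_pre_digraph \<Rightarrow> ('a \<Rightarrow> real) \<Rightarrow> real" where
  "sup_norm G f = Max ((\<lambda>x. \<bar>f x\<bar>) ` pverts G)"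

text \<open>The first time the sup-distance to \<open>h\<close> is at most \<open>\<epsilon>\<close>, and \<open>\<infinity>\<close> if there is no such time.\<close>

definition tau_star ::
    "'a pair_pre_digraph \<Rightarrow> (nat \<Rightarrow> 'a \<Rightarrow> real) \<Rightarrow> ('a \<Rightarrow> real) \<Rightarrow> real \<Rightarrow> enat" where
  "tau_star G f h \<epsilon> = (INF t\<in>{t. sup_norm G (\<lambda>x. f t x - h x) \<le> \<epsilon>}. enat t)"

end

theory Submission
  imports Defs
begin

text \<open>
  Call \<open>f\<close> a supersolution if \<open>midrange G f \<le> f\<close> on \<open>V\<close>. A supersolution that agrees with \<open>h\<close> on
  \<open>B\<close> decreases under the dynamics, and a full round brings it below the simultaneous update
  \<open>midrange G f\<close>. Hence it suffices that every value of \<open>f - h\<close> is at most \<open>n R\<close>, where \<open>R\<close> is the sum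
  over \<open>V\<close> of the gaps \<open>2 (f - midrange G f)\<close>: each round then contracts the sum of \<open>f - h\<close> by the
  factor \<open>1 - 1/(2n\<^sup>2)\<close>.

  The gap at a vertex is the difference of the downward and the upward slope of \<open>f\<close>. Let \<open>D\<close> be the
  maximal slope of \<open>h\<close> on the set \<open>S\<close> where \<open>f - h > c\<close>, for some \<open>c \<ge> 0\<close>. If \<open>f\<close> had a downward
  slope larger than \<open>D + R\<close> somewhere in \<open>S\<close>, one could climb \<open>f\<close> from there with upward slopes larger
  than \<open>D\<close>, since the gaps use up at most \<open>R\<close>; but then \<open>f - h\<close> increases, so the climb
  stays in \<open>S\<close> and never ends. From a vertex of \<open>S\<close> at which \<open>h\<close> has slope \<open>D\<close>, some
  simple path of \<open>k\<close> such vertices leads out of \<open>S\<close> while \<open>h\<close> drops by \<open>k D\<close> and \<open>f\<close> by at most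
  \<open>k (D + R)\<close>, so \<open>f - h \<le> c + k R\<close> at its start. Raising \<open>c\<close> step by step from \<open>0\<close> charges every
  vertex at most once, which gives \<open>n R\<close>.

  An arbitrary \<open>f0\<close> lies between the supersolution that is \<open>1\<close> on \<open>V\<close> and the subsolution that is \<open>0\<close>
  on \<open>V\<close>. Their initial distances \<open>1 - h\<close> and \<open>h\<close> from \<open>h\<close> add up to \<open>n\<close>, so using both bounds costs
  no factor \<open>2\<close>.
\<close>

section \<open>Graphs with boundary and the midrange operator\<close>

locale boundary_graph =
  fixes G :: "'a pair_pre_digraph" and B V :: "'a set"
  assumes graph: "graph_with_boundary G B V"
begin

lemma finite_V: "finite V" and finite_B: "finite B"
  and disjoint: "V \<inter> B = {}" and V_ne: "V \<noteq> {}" and B_ne: "B \<noteq> {}"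
  and pverts_eq: "pverts G = V \<union> B"
proof -
  have pg: "pair_graph G" and p: "pverts G = V \<union> B" "V \<inter> B = {}" "V \<noteq> {}" "B \<noteq> {}"
    using graph by (auto simp: graph_with_boundary_def)
  interpret pair_graph G by (rule pg)
  show "finite V" "finite B" using pair_finite_verts p by auto
  show "V \<inter> B = {}" "V \<noteq> {}" "B \<noteq> {}" "pverts G = V \<union> B" using p by auto
qed

lemma nbrs_subset: "nbrs G x \<subseteq> V \<union> B"
  and nbrs_sym: "y \<in> nbrs G x \<Longrightarrow> x \<in> nbrs G y"
proof -
  have pg: "pair_graph G" and p: "pverts G = V \<union> B"
    using graph by (auto simp: graph_with_boundary_def)
  interpret pair_graph G by (rule pg)
  show "nbrs G x \<subseteq> V \<union> B" using in_arcsD2 p by (auto simp: nbrs_def)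
  show "x \<in> nbrs G y" if "y \<in> nbrs G x"
    using pair_sym_arcs that by (auto simp: nbrs_def symmetric_def dest: symD)
qed

lemma finite_nbrs: "finite (nbrs G x)"
  using nbrs_subset finite_V finite_B by (meson finite_UnI finite_subset)

text \<open>Connectedness enters the argument only through this lemma: a path from \<open>x\<close>
  to a boundary vertex cannot leave a set closed under neighbours.\<close>

lemma closed_meets_B:
  assumes "x \<in> S" "S \<subseteq> V \<union> B" and closed: "\<And>y z. y \<in> S \<Longrightarrow> z \<in> nbrs G y \<Longrightarrow> z \<in> S"
  shows "S \<inter> B \<noteq> {}"
proof -
  have pg: "pair_graph G" and con: "Digraph_Component.connected (with_proj G)"
    using graph by (auto simp: graph_with_boundary_def)
  interpret pair_graph G by (rule pg)
  obtain b where b: "b \<in> B" using B_ne by blast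
  have "strongly_connected (with_proj G)"
    using symmetric_connected_imp_strongly_connected con pair_sym_arcs by blast
  then have "x \<rightarrow>\<^sup>*\<^bsub>with_proj G\<^esub> b"
    using assms b pverts_eq by (auto simp: strongly_connected_def)
  then have "(x, b) \<in> (parcs G)\<^sup>*"
    using reachable_rtranclI by fastforce
  then have "b \<in> S"
    by (induction rule: rtrancl_induct) (use assms(1) closed in \<open>auto simp: nbrs_def\<close>)
  with b show ?thesis by blast
qed

lemma nbrs_ne:
  assumes "x \<in> V"
  shows "nbrs G x \<noteq> {}"
  \<comment> \<open>If \<open>x\<close> were isolated, \<open>{x}\<close> would be closed under
    neighbours without meeting \<open>B\<close>.\<close>
  using closed_meets_B[of x "{x}"] assms disjoint by auto

lemma midrange_mono:
  assumes "x \<in> V" "\<And>y. y \<in> nbrs G x \<Longrightarrow> f y \<le> g y"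
  shows "midrange G f x \<le> midrange G g x"
proof -
  note [simp] = finite_nbrs nbrs_ne[OF assms(1)]
  have "Max (f ` nbrs G x) \<le> Max (g ` nbrs G x)"
    by (intro Max.boundedI) (auto intro: order_trans[OF assms(2)])
  moreover have "Min (f ` nbrs G x) \<le> Min (g ` nbrs G x)"
    by (intro Min.boundedI) (auto intro: order_trans[OF _ assms(2)])
  ultimately show ?thesis
    unfolding midrange_def by (intro divide_right_mono add_mono) simp_all
qed

lemma midrange_uminus:
  assumes "x \<in> V"
  shows "midrange G (\<lambda>y. - f y) x = - midrange G f x"
proof -
  have eq: "(\<lambda>y. - f y) ` nbrs G x = uminus ` f ` nbrs G x" by auto
  have mx: "Max (uminus ` f ` nbrs G x) = - Min (f ` nbrs G x)"
    by (rule minus_Min_eq_Max[symmetric]) (simp_all add: finite_nbrs nbrs_ne[OF assms])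
  have mn: "Min (uminus ` f ` nbrs G x) = - Max (f ` nbrs G x)"
    by (rule minus_Max_eq_Min[symmetric]) (simp_all add: finite_nbrs nbrs_ne[OF assms])
  show ?thesis
    unfolding midrange_def eq mx mn by (simp add: field_simps)
qed

lemma midrange_const:
  assumes "x \<in> V"
  shows "midrange G (\<lambda>y. c) x = c"
  using nbrs_ne[OF assms] by (simp add: midrange_def image_constant_conv)

section \<open>Supersolutions, gaps and slopes\<close>

definition supersolution :: "('a \<Rightarrow> real) \<Rightarrow> bool" where
  "supersolution f \<longleftrightarrow> (\<forall>x\<in>V. midrange G f x \<le> f x)"

definition downslope :: "('a \<Rightarrow> real) \<Rightarrow> 'a \<Rightarrow> real" where
  "downslope f x = f x - Min (f ` nbrs G x)"

definition upslope :: "('a \<Rightarrow> real) \<Rightarrow> 'a \<Rightarrow> real" where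
  "upslope f x = Max (f ` nbrs G x) - f x"

lemma gap_eq_slopes: "2 * (f x - midrange G f x) = downslope f x - upslope f x"
  by (simp add: midrange_def downslope_def upslope_def field_simps)

lemma downslope_ge: "y \<in> nbrs G x \<Longrightarrow> f x - f y \<le> downslope f x"
  by (simp add: downslope_def finite_nbrs)

lemma upslope_ge: "y \<in> nbrs G x \<Longrightarrow> f y - f x \<le> upslope f x"
  by (simp add: upslope_def finite_nbrs)

lemma downslope_attained:
  assumes "x \<in> V"
  obtains y where "y \<in> nbrs G x" "f y = f x - downslope f x"
proof -
  have "Min (f ` nbrs G x) \<in> f ` nbrs G x"
    using finite_nbrs nbrs_ne[OF assms] by (intro Min_in) auto
  then show thesis using that by (auto simp: downslope_def)
qed

lemma upslope_attained:
  assumes "x \<in> V"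
  obtains y where "y \<in> nbrs G x" "f y = f x + upslope f x"
proof -
  have "Max (f ` nbrs G x) \<in> f ` nbrs G x"
    using finite_nbrs nbrs_ne[OF assms] by (intro Max_in) auto
  then show thesis using that by (auto simp: upslope_def)
qed

section \<open>Infinity harmonic functions: minimum principle and steepest descent\<close>

lemma harmonic_slopes_eq:
  assumes "infinity_harmonic_on G V h" "x \<in> V"
  shows "upslope h x = downslope h x"
  using gap_eq_slopes[of h x] assms by (simp add: infinity_harmonic_on_def)

lemma harmonic_downslope_nonneg:
  assumes "infinity_harmonic_on G V h" "x \<in> V"
  shows "0 \<le> downslope h x"
proof -
  obtain y where "y \<in> nbrs G x" using nbrs_ne assms(2) by blast
  then show ?thesis
    using downslope_ge[of y x h] upslope_ge[of y x h] harmonic_slopes_eq[OF assms] by linarith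
qed

text \<open>Minimum principle. At an interior minimum the downward slope is at most 0, hence so is
  the upward slope, and all neighbours are minima too. So the set of minima cannot avoid
  \<open>B\<close>.\<close>

lemma harmonic_attains_below:
  assumes h: "infinity_harmonic_on G V h" and "x \<in> V"
  shows "\<exists>b\<in>B. h b \<le> h x"
proof -
  define c where "c = Min (h ` (V \<union> B))"
  have min: "c \<le> h y" if "y \<in> V \<union> B" for y
    using that finite_V finite_B by (simp add: c_def)
  have "c \<in> h ` (V \<union> B)"
    unfolding c_def using finite_V finite_B V_ne by (intro Min_in) auto
  then obtain z where z: "z \<in> V \<union> B" "h z = c" by blast
  have "{y \<in> V \<union> B. h y = c} \<inter> B \<noteq> {}"
  proof (rule ccontr)
    assume "\<not> ?thesis"
    then have *: "{y \<in> V \<union> B. h y = c} \<inter> B = {}" by simp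
    have "{y \<in> V \<union> B. h y = c} \<inter> B \<noteq> {}"
    proof (rule closed_meets_B[of z])
      fix y u assume y: "y \<in> {y \<in> V \<union> B. h y = c}" and u: "u \<in> nbrs G y"
      have yV: "y \<in> V" using y * by blast
      obtain w where w: "w \<in> nbrs G y" "h w = h y - downslope h y"
        using downslope_attained[OF yV] by metis
      have "downslope h y \<le> 0"
        using w y min[of w] nbrs_subset[of y] by auto
      then have "h u \<le> c"
        using upslope_ge[OF u, of h] harmonic_slopes_eq[OF h yV] y by auto
      then show "u \<in> {y \<in> V \<union> B. h y = c}"
        using u nbrs_subset[of y] min[of u] by auto
    qed (use z in auto)
    with * show False by blast
  qed
  then show ?thesis using min assms(2) by auto
qed

lemma harmonic_uminus:
  assumes "infinity_harmonic_on G V h"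
  shows "infinity_harmonic_on G V (\<lambda>x. - h x)"
  using assms by (simp add: infinity_harmonic_on_def midrange_uminus)

text \<open>Suppose the set \<open>R\<close> reachable from \<open>x\<close> stays inside
  \<open>S\<close>. Then all its vertices have slope \<open>D\<close>. If \<open>D = 0\<close>, it
  is closed under neighbours and so meets \<open>B\<close>; if \<open>D > 0\<close>, its lowest
  vertex still has a lower neighbour in it.\<close>

lemma steepest_descent_leaves:
  assumes h: "infinity_harmonic_on G V h" and S: "S \<subseteq> V" and x: "x \<in> S"
    and steepest: "\<And>y. y \<in> S \<Longrightarrow> downslope h y \<le> downslope h x"
  defines "D \<equiv> downslope h x"
  shows "\<exists>y. (x, y) \<in>
    {(p, q). p \<in> S \<and> downslope h p = D \<and> q \<in> nbrs G p \<and> h q = h p - D}\<^sup>* \<and> y \<notin> S"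
    (is "\<exists>y. (x, y) \<in> ?E\<^sup>* \<and> y \<notin> S")
proof (rule ccontr)
  assume "\<not> ?thesis"
  then have in_S: "y \<in> S" if "(x, y) \<in> ?E\<^sup>*" for y using that by blast
  define R where "R = {y. (x, y) \<in> ?E\<^sup>*}"
  have xR: "x \<in> R" and R_sub: "R \<subseteq> S" using in_S by (auto simp: R_def)
  have D0: "0 \<le> D" using harmonic_downslope_nonneg[OF h] x S by (auto simp: D_def)
  have slope: "downslope h y = D" if "y \<in> R" for y
  proof -
    have "(x, y) \<in> ?E\<^sup>*" using that by (simp add: R_def)
    then show ?thesis
    proof (cases rule: rtranclE)
      case base
      then show ?thesis by (simp add: D_def)
    next
      case (step p)
      have yS: "y \<in> S" using that R_sub by blast
      \<comment> \<open>The arc from \<open>p\<close> into \<open>y\<close>, read backwards, is an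
        upward slope \<open>D\<close> at \<open>y\<close>; harmonicity turns it into a downward
        one.\<close>
      have "D \<le> upslope h y"
        using step(2) upslope_ge[OF nbrs_sym, of y p h] by auto
      then show ?thesis
        using steepest[OF yS] harmonic_slopes_eq[OF h, of y] yS S by (auto simp: D_def)
    qed
  qed
  have arc: "z \<in> R" if "y \<in> R" "z \<in> nbrs G y" "h z = h y - D" for y z
    using that slope[OF that(1)] R_sub unfolding R_def by (auto intro: rtrancl_into_rtrancl)
  show False
  proof (cases "D = 0")
    case True
    have "R \<inter> B \<noteq> {}"
    proof (rule closed_meets_B[OF xR])
      show "R \<subseteq> V \<union> B" using R_sub S by blast
      fix y z assume yz: "y \<in> R" "z \<in> nbrs G y"
      have "h z = h y"
        using downslope_ge[OF yz(2), of h] upslope_ge[OF yz(2), of h]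
          harmonic_slopes_eq[OF h, of y] slope[OF yz(1)] True yz(1) R_sub S by fastforce
      then show "z \<in> R" using arc[OF yz] True by simp
    qed
    then show False using R_sub S disjoint by blast
  next
    case False
    have finR: "finite R" using finite_subset[OF subset_trans[OF R_sub S] finite_V] .
    have "Min (h ` R) \<in> h ` R" using finR xR by (intro Min_in) auto
    then obtain y where y: "y \<in> R" "h y = Min (h ` R)" by auto
    obtain z where z: "z \<in> nbrs G y" "h z = h y - downslope h y"
      using downslope_attained[of y h] y(1) R_sub S by (metis subsetD)
    then have "z \<in> R" using arc y(1) slope by simp
    then have "h y \<le> h z" using y(2) finR by simp
    then show False using z slope[OF y(1)] D0 False by simp
  qed
qed

lemma steepest_descent_path:
  assumes h: "infinity_harmonic_on G V h" and S: "S \<subseteq> V" and x: "x \<in> S"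
    and steepest: "\<And>y. y \<in> S \<Longrightarrow> downslope h y \<le> downslope h x"
  defines "D \<equiv> downslope h x"
  obtains k w where "w 0 = x" "w k \<in> V \<union> B - S" "k \<le> card {y\<in>S. downslope h y = D}"
    "\<And>i. i < k \<Longrightarrow> w i \<in> S" "\<And>i. i < k \<Longrightarrow> w (Suc i) \<in> nbrs G (w i)"
    "h (w k) = h x - real k * D"
proof -
  define E where "E = {(p, q). p \<in> S \<and> downslope h p = D \<and> q \<in> nbrs G p \<and> h q = h p - D}"
  obtain y where y: "(x, y) \<in> E\<^sup>*" "y \<notin> S"
    using steepest_descent_leaves[OF h S x steepest] unfolding E_def D_def by blast
  \<comment> \<open>A shortest walk repeats no vertex, since the part between two equal vertices
    could be cut out. This bounds \<open>k\<close> by the number of steepest vertices.\<close>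
  define k where "k = (LEAST k. (x, y) \<in> E ^^ k)"
  have "\<exists>k. (x, y) \<in> E ^^ k" using y(1) by (auto dest: rtrancl_imp_relpow)
  then have k: "(x, y) \<in> E ^^ k" unfolding k_def by (rule LeastI_ex)
  have least: "k \<le> j" if "(x, y) \<in> E ^^ j" for j unfolding k_def using that by (rule Least_le)
  from k obtain w where w: "w 0 = x" "w k = y" and arcs: "\<forall>i<k. (w i, w (Suc i)) \<in> E"
    by (auto simp: relpow_fun_conv)
  have inj: "inj_on w {..<k}"
  proof (rule linorder_inj_onI')
    fix i j assume ij: "i \<in> {..<k}" "j \<in> {..<k}" "i < j"
    show "w i \<noteq> w j"
    proof
      assume eq: "w i = w j"
      have "(x, w i) \<in> E ^^ i"
        unfolding relpow_fun_conv using w arcs ij by (intro exI[of _ w]) auto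
      moreover have "(w j, y) \<in> E ^^ (k - j)"
        unfolding relpow_fun_conv using w arcs ij by (intro exI[of _ "\<lambda>l. w (j + l)"]) auto
      ultimately have "(x, y) \<in> E ^^ (i + (k - j))"
        using eq by (auto simp: relpow_add)
      then show False using least[of "i + (k - j)"] ij by auto
    qed
  qed
  have step: "w i \<in> S" "downslope h (w i) = D" "w (Suc i) \<in> nbrs G (w i)"
    "h (w (Suc i)) = h (w i) - D" if "i < k" for i
    using arcs that by (auto simp: E_def)
  have descent: "h (w i) = h x - real i * D" if "i \<le> k" for i
    using that by (induction i) (auto simp: w step algebra_simps)
  have "card (w ` {..<k}) \<le> card {y\<in>S. downslope h y = D}"
    using step finite_subset[OF S finite_V] by (intro card_mono) auto
  then have "k \<le> card {y\<in>S. downslope h y = D}" using inj by (simp add: card_image)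
  moreover have "w k \<in> V \<union> B - S"
  proof (cases k)
    case 0
    then show ?thesis using w y(2) x by simp
  next
    case (Suc i)
    then show ?thesis using w y(2) step(3)[of i] nbrs_subset by auto
  qed
  ultimately show thesis using that[of w k] w(1) step descent by auto
qed

section \<open>The excess of a supersolution is controlled by its gaps\<close>

text \<open>
  Only the gaps at vertices at or above the level \<open>f y\<close> are charged, so that the bound survives the
  induction along an upward step of \<open>f\<close>.
\<close>

lemma downslope_super_le:
  assumes h: "infinity_harmonic_on G V h" and super: "supersolution f"
    and bd: "\<And>b. b \<in> B \<Longrightarrow> f b = h b" and c: "0 \<le> c" and \<Lambda>: "0 \<le> \<Lambda>"
    and slope: "\<And>y. y \<in> V \<Longrightarrow> c < f y - h y \<Longrightarrow> downslope h y \<le> \<Lambda>"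
    and y: "y \<in> V" "c < f y - h y"
  shows "downslope f y \<le> \<Lambda> + (\<Sum>z | z \<in> V \<and> f y \<le> f z. 2 * (f z - midrange G f z))"
  using y
proof (induction "card {z\<in>V. f y < f z}" arbitrary: y rule: less_induct)
  case less
  define gap where "gap z = 2 * (f z - midrange G f z)" for z
  have gap_nonneg: "0 \<le> gap z" if "z \<in> V" for z
    using super that by (simp add: supersolution_def gap_def)
  have up: "upslope f y = downslope f y - gap y"
    using gap_eq_slopes[of f y] by (simp add: gap_def)
  have split: "gap y + sum gap {z\<in>V. f y < f z} \<le> sum gap {z\<in>V. f y \<le> f z}"
  proof -
    have "gap y + sum gap {z\<in>V. f y < f z} = sum gap (insert y {z\<in>V. f y < f z})"
      using finite_V by simp
    also have "\<dots> \<le> sum gap {z\<in>V. f y \<le> f z}"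
      using finite_V less.prems gap_nonneg by (intro sum_mono2) auto
    finally show ?thesis .
  qed
  show ?case
  proof (rule ccontr)
    assume "\<not> ?thesis"
    \<comment> \<open>The gap at \<open>y\<close> pays for passing from the downward to the upward
      slope, which leaves only the gaps strictly above \<open>f y\<close>.\<close>
    then have steep: "\<Lambda> + sum gap {z\<in>V. f y < f z} < upslope f y"
      using split up by (simp add: gap_def)
    have "0 \<le> sum gap {z\<in>V. f y < f z}"
      using gap_nonneg by (intro sum_nonneg) auto
    then have pos: "\<Lambda> < upslope f y" using steep by linarith
    obtain u where u: "u \<in> nbrs G y" "f u = f y + upslope f y"
      using upslope_attained[OF less.prems(1)] by metis
    have "h u - h y \<le> \<Lambda>"
      using upslope_ge[OF u(1), of h] harmonic_slopes_eq[OF h less.prems(1)]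
        slope[OF less.prems] by simp
    \<comment> \<open>Along this arc \<open>f\<close> rises by more than \<Lambda> and
      \<open>h\<close> by at most \<Lambda>, so the excess grows; as it is 0 on \<open>B\<close>,
      the vertex \<open>u\<close> is interior.\<close>
    then have gu: "c < f u - h u" using u(2) pos less.prems(2) by linarith
    then have uV: "u \<in> V" using bd[of u] c u(1) nbrs_subset[of y] by auto
    have fu: "f y < f u" using u(2) pos \<Lambda> by linarith
    have "{z\<in>V. f u < f z} \<subset> {z\<in>V. f y < f z}" using fu uV by auto
    then have "card {z\<in>V. f u < f z} < card {z\<in>V. f y < f z}"
      using finite_V by (intro psubset_card_mono) auto
    from less.hyps[OF this uV gu]
    have "downslope f u \<le> \<Lambda> + sum gap {z\<in>V. f u \<le> f z}" by (simp add: gap_def)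
    also have "\<dots> \<le> \<Lambda> + sum gap {z\<in>V. f y < f z}"
      using fu finite_V gap_nonneg by (intro add_left_mono sum_mono2) auto
    \<comment> \<open>Seen from \<open>u\<close>, the arc to \<open>y\<close> is a downward slope
      equal to \<open>upslope f y\<close>.\<close>
    finally show False
      using steep downslope_ge[OF nbrs_sym[OF u(1)], of f] u(2) by linarith
  qed
qed

text \<open>Only \<open>c = 0\<close> is needed later; an arbitrary level allows induction on the
  number of vertices above it. The steepest vertices \<open>X\<close> of \<open>h\<close> among
  these have excess at most \<open>c + card X * R\<close>, so raising the level by
  \<open>card X * R\<close> discards all of them.\<close>

lemma excess_le:
  assumes h: "infinity_harmonic_on G V h" and super: "supersolution f"
    and bd: "\<And>b. b \<in> B \<Longrightarrow> f b = h b" and c: "0 \<le> c" and x: "x \<in> V"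
  shows "f x - h x \<le> c + real (card {y\<in>V. c < f y - h y}) *
    (\<Sum>z\<in>V. 2 * (f z - midrange G f z))"
  using c
proof (induction "card {y\<in>V. c < f y - h y}" arbitrary: c rule: less_induct)
  case less
  define R where "R = (\<Sum>z\<in>V. 2 * (f z - midrange G f z))"
  define S where "S = {y\<in>V. c < f y - h y}"
  have SV: "S \<subseteq> V" and finS: "finite S" using finite_V by (auto simp: S_def)
  have gap_nonneg: "0 \<le> 2 * (f z - midrange G f z)" if "z \<in> V" for z
    using super that by (simp add: supersolution_def)
  then have R0: "0 \<le> R" unfolding R_def by (rule sum_nonneg)
  show ?case
  proof (cases "S = {}")
    case True
    then have "f x - h x \<le> c" using x by (force simp: S_def)
    moreover have "0 \<le> real (card S) * R" using R0 by simp
    ultimately show ?thesis unfolding S_def R_def by linarith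
  next
    case False
    define \<Lambda> where "\<Lambda> = Max (downslope h ` S)"
    have slope: "downslope h y \<le> \<Lambda>" if "y \<in> S" for y
      using that finS by (simp add: \<Lambda>_def)
    have "\<Lambda> \<in> downslope h ` S" unfolding \<Lambda>_def using finS False by (intro Max_in) auto
    then obtain x0 where x0: "x0 \<in> S" "downslope h x0 = \<Lambda>" by auto
    have \<Lambda>0: "0 \<le> \<Lambda>" using x0 SV harmonic_downslope_nonneg[OF h, of x0] by auto
    define X where "X = {y\<in>S. downslope h y = \<Lambda>}"
    have X: "X \<subseteq> S" "x0 \<in> X" using x0 by (auto simp: X_def)
    have slope_f: "downslope f y \<le> \<Lambda> + R" if "y \<in> S" for y
    proof -
      have "downslope f y \<le> \<Lambda> + (\<Sum>z | z \<in> V \<and> f y \<le> f z. 2 * (f z - midrange G f z))"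
        using that slope by (intro downslope_super_le[OF h super bd less.prems \<Lambda>0])
          (auto simp: S_def)
      also have "\<dots> \<le> \<Lambda> + R"
        unfolding R_def using finite_V gap_nonneg by (intro add_left_mono sum_mono2) auto
      finally show ?thesis .
    qed
    have X_le: "f y - h y \<le> c + real (card X) * R" if y: "y \<in> X" for y
    proof -
      have yS: "y \<in> S" and Dy: "downslope h y = \<Lambda>" using y by (auto simp: X_def)
      have steepest: "downslope h z \<le> downslope h y" if "z \<in> S" for z
        using slope[OF that] Dy by simp
      show ?thesis
      proof (rule steepest_descent_path[OF h SV yS steepest, unfolded Dy, folded X_def])
        fix k w
        assume w: "w 0 = y" "w k \<in> V \<union> B - S" "k \<le> card X"
        "\<And>i. i < k \<Longrightarrow> w i \<in> S" "\<And>i. i < k \<Longrightarrow> w (Suc i) \<in> nbrs G (w i)"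
        "h (w k) = h y - real k * \<Lambda>"
      \<comment> \<open>Each arc lowers \<open>f\<close> by at most \<open>\<Lambda> + R\<close> and
        \<open>h\<close> by \<Lambda> on average, so the excess loses at most \<open>k * R\<close>
        along the path.\<close>
      have "f y - f (w k) = (\<Sum>i<k. f (w i) - f (w (Suc i)))"
        using sum_lessThan_telescope'[of "\<lambda>i. f (w i)" k] w(1) by simp
      also have "\<dots> \<le> (\<Sum>i<k. \<Lambda> + R)"
      proof (rule sum_mono)
        fix i assume "i \<in> {..<k}"
        then have "i < k" by simp
        then show "f (w i) - f (w (Suc i)) \<le> \<Lambda> + R"
          using slope_f[OF w(4)] downslope_ge[OF w(5), of i f] by fastforce
      qed
      finally have "f y - h y \<le> (f (w k) - h (w k)) + real k * R"
        using w(6) by (simp add: algebra_simps)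
      \<comment> \<open>The endpoint is either an interior vertex outside \<open>S\<close> or a
        boundary vertex with excess 0.\<close>
      also have "f (w k) - h (w k) \<le> c"
        using w(2) bd less.prems by (auto simp: S_def)
      also have "real k * R \<le> real (card X) * R"
        using w(3) R0 by (intro mult_right_mono) auto
      finally show "f y - h y \<le> c + real (card X) * R" by simp
      qed
    qed
    define c' where "c' = c + real (card X) * R"
    define S' where "S' = {y\<in>V. c' < f y - h y}"
    have "c \<le> c'" using R0 by (simp add: c'_def)
    then have "S' \<subseteq> S - X" using X_le by (force simp: S'_def S_def c'_def)
    then have "card S' \<le> card (S - X)" using finS by (intro card_mono) auto
    also have "\<dots> = card S - card X"
      using X(1) finS by (intro card_Diff_subset) (auto intro: finite_subset)
    finally have card: "card S' + card X \<le> card S"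
      using card_mono[OF finS X(1)] by linarith
    have "0 < card X" using X finS finite_subset by (auto simp: card_gt_0_iff)
    then have "card S' < card S" using card by linarith
    then have "f x - h x \<le> c' + real (card S') * R"
      using less.hyps[of c'] less.prems \<open>c \<le> c'\<close> by (simp add: S_def S'_def R_def)
    also have "\<dots> = c + real (card S' + card X) * R" by (simp add: c'_def algebra_simps)
    also have "\<dots> \<le> c + real (card S) * R"
      using card R0 by (intro add_left_mono mult_right_mono) auto
    finally show ?thesis by (simp add: S_def R_def)
  qed
qed

text \<open>One factor \<open>card V\<close> comes from \<open>excess_le\<close>, the other from
  summing over \<open>V\<close>, and the 2 from the normalisation of the gaps.\<close>

lemma gap_sum_ge:
  assumes h: "infinity_harmonic_on G V h" and super: "supersolution f"
    and bd: "\<And>b. b \<in> B \<Longrightarrow> f b = h b"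
  shows "(\<Sum>y\<in>V. f y - h y) \<le> 2 * real (card V) ^ 2 * (\<Sum>y\<in>V. f y - midrange G f y)"
proof -
  define R where "R = (\<Sum>z\<in>V. 2 * (f z - midrange G f z))"
  have "0 \<le> R" unfolding R_def
    using super by (intro sum_nonneg) (simp add: supersolution_def)
  moreover have "card {y\<in>V. 0 < f y - h y} \<le> card V"
    using finite_V by (intro card_mono) auto
  ultimately have "real (card {y\<in>V. 0 < f y - h y}) * R \<le> real (card V) * R"
    by (intro mult_right_mono) auto
  then have "f y - h y \<le> real (card V) * R" if "y \<in> V" for y
    using excess_le[OF h super bd order_refl that] unfolding R_def by fastforce
  then have "(\<Sum>y\<in>V. f y - h y) \<le> real (card V) * (real (card V) * R)"
    by (rule sum_bounded_above)
  moreover have "R = 2 * (\<Sum>y\<in>V. f y - midrange G f y)"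
    unfolding R_def by (rule sum_distrib_left[symmetric])
  ultimately show ?thesis
    by (simp add: power2_eq_square mult_ac)
qed

end

section \<open>Round robin schedules\<close>

lemma round_robin_shift:
  assumes "round_robin V v" "1 \<le> i"
  shows "v (i + k * card V) = v i"
proof (induction k)
  case (Suc k)
  have "v ((i + k * card V) + card V) = v (i + k * card V)"
    using assms by (auto simp: round_robin_def)
  then show ?case using Suc by (simp add: algebra_simps)
qed simp

lemma round_robin_hits:
  assumes "round_robin V v" "x \<in> V"
  obtains i where "i < card V" "v (Suc (k * card V + i)) = x"
proof -
  have "x \<in> v ` {1..card V}"
    using assms by (auto simp: round_robin_def bij_betw_def)
  then obtain j where j: "1 \<le> j" "j \<le> card V" "v j = x" by auto
  \<comment> \<open>Update times start at 1, so round \<open>k\<close> has the times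
    \<open>Suc (k * card V + i)\<close> with \<open>i < card V\<close>; hence the shift to
    \<open>j - 1\<close>.\<close>
  then show thesis
    using that[of "j - 1"] round_robin_shift[OF assms(1) j(1), of k] by (simp add: algebra_simps)
qed

lemma round_robin_in:
  assumes "round_robin V v" "finite V" "V \<noteq> {}"
  shows "v (Suc t) \<in> V"
proof -
  define n where "n = card V"
  have n: "0 < n" using assms by (simp add: n_def card_gt_0_iff)
  have "v (Suc (t mod n) + (t div n) * n) = v (Suc (t mod n))"
    unfolding n_def by (rule round_robin_shift[OF assms(1)]) simp
  moreover have "Suc (t mod n) + (t div n) * n = Suc t" by simp
  moreover have "v (Suc (t mod n)) \<in> V"
    using assms(1) n by (auto simp: round_robin_def bij_betw_def n_def Suc_le_eq)
  ultimately show ?thesis by metis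
qed

section \<open>The learning dynamics: comparison and contraction per round\<close>

locale learning = boundary_graph +
  fixes v :: "nat \<Rightarrow> 'a"
  assumes round_robin: "round_robin V v"
begin

abbreviation L :: "('a \<Rightarrow> real) \<Rightarrow> nat \<Rightarrow> 'a \<Rightarrow> real" where
  "L \<equiv> lipschitz_learning G v"

lemma update_in: "v (Suc t) \<in> V"
  using round_robin_in[OF round_robin finite_V V_ne] .

lemma learning_boundary: "b \<in> B \<Longrightarrow> L f t b = f b"
  by (induction t) (use update_in disjoint in \<open>auto simp: disjoint_iff\<close>)

lemma learning_mono:
  assumes "\<And>x. x \<in> V \<union> B \<Longrightarrow> f x \<le> g x" "x \<in> V \<union> B"
  shows "L f t x \<le> L g t x"
  using assms(2)
proof (induction t arbitrary: x)
  case (Suc t)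
  then show ?case
    using midrange_mono[OF update_in, of t "L f t" "L g t"] nbrs_subset by auto
qed (use assms in auto)

text \<open>Negation swaps maximum and minimum, so lower bounds follow from the treatment of
  supersolutions.\<close>

lemma learning_uminus: "L (\<lambda>x. - f x) t = (\<lambda>x. - L f t x)"
proof (induction t)
  case (Suc t)
  show ?case
    by (rule ext) (simp only: Suc lipschitz_learning.simps fun_upd_apply midrange_uminus[OF update_in]
      if_distrib[of uminus])
qed simp

lemma learning_super:
  assumes "supersolution f"
  shows "supersolution (L f t)"
proof (induction t)
  case (Suc t)
  have le: "L f (Suc t) y \<le> L f t y" for y
    using Suc update_in by (auto simp: supersolution_def)
  show ?case
    unfolding supersolution_def
  proof
    fix x assume x: "x \<in> V"
    have "midrange G (L f (Suc t)) x \<le> midrange G (L f t) x"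
      by (rule midrange_mono[OF x le])
    \<comment> \<open>Equality holds at the updated vertex; any other value is unchanged.\<close>
    also have "\<dots> \<le> L f (Suc t) x"
      using Suc x by (simp add: supersolution_def)
    finally show "midrange G (L f (Suc t)) x \<le> L f (Suc t) x" .
  qed
qed (use assms in simp)

lemma learning_decreasing:
  assumes "supersolution f" "s \<le> t"
  shows "L f t x \<le> L f s x"
  using assms(2)
proof (induction t rule: dec_induct)
  case (step t)
  have "L f (Suc t) x \<le> L f t x"
    using learning_super[OF assms(1), of t] update_in by (auto simp: supersolution_def)
  with step show ?case by simp
qed simp

text \<open>When \<open>x\<close> is updated during the round, its neighbours are no higher than at
  the start of the round; afterwards the value at \<open>x\<close> only decreases.\<close>

lemma learning_round:
  assumes "supersolution f" "x \<in> V"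
  shows "L f (Suc k * card V) x \<le> midrange G (L f (k * card V)) x"
proof -
  obtain i where i: "i < card V" "v (Suc (k * card V + i)) = x"
    using round_robin_hits[OF round_robin assms(2)] .
  have "L f (Suc k * card V) x \<le> L f (Suc (k * card V + i)) x"
    using i by (intro learning_decreasing[OF assms(1)]) auto
  also have "\<dots> = midrange G (L f (k * card V + i)) x"
    using i by simp
  also have "\<dots> \<le> midrange G (L f (k * card V)) x"
    by (intro midrange_mono[OF assms(2)] learning_decreasing[OF assms(1)]) simp
  finally show ?thesis .
qed

text \<open>\<open>h\<close> is a fixed point of the dynamics, which preserve order.\<close>

lemma learning_ge_harmonic:
  assumes h: "infinity_harmonic_on G V h" and "\<And>x. x \<in> V \<union> B \<Longrightarrow> h x \<le> f x" "x \<in> V \<union> B"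
  shows "h x \<le> L f t x"
proof -
  have "L h t = h"
  proof (induction t)
    case (Suc t)
    have "midrange G h (v (Suc t)) = h (v (Suc t))"
      using h update_in[of t] by (simp add: infinity_harmonic_on_def)
    then show ?case by (simp only: lipschitz_learning.simps Suc fun_upd_triv)
  qed simp
  moreover have "L h t x \<le> L f t x"
    by (rule learning_mono[OF assms(2,3)])
  ultimately show ?thesis by simp
qed

lemma supersolution_rate:
  assumes h: "infinity_harmonic_on G V h" and super: "supersolution f"
    and bd: "\<And>b. b \<in> B \<Longrightarrow> f b = h b"
  defines "q \<equiv> 1 - 1 / (2 * real (card V) ^ 2)"
  shows "(\<Sum>y\<in>V. L f t y - h y) \<le> q ^ (t div card V) * (\<Sum>y\<in>V. f y - h y)"
proof -
  define n where "n = card V"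
  have n: "1 \<le> n" using finite_V V_ne by (simp add: n_def Suc_le_eq card_gt_0_iff)
  then have "1 \<le> real n ^ 2" by simp
  then have "1 / (2 * real n ^ 2) \<le> 1 / 1" by (intro frac_le) linarith+
  then have q: "0 \<le> q" by (simp add: q_def n_def[symmetric])
  have rounds: "(\<Sum>y\<in>V. L f (k * n) y - h y) \<le> q ^ k * (\<Sum>y\<in>V. f y - h y)" for k
  proof (induction k)
    case (Suc k)
    let ?g = "L f (k * n)"
    have gap: "(\<Sum>y\<in>V. ?g y - h y) \<le> 2 * real n ^ 2 * (\<Sum>y\<in>V. ?g y - midrange G ?g y)"
      unfolding n_def
      by (intro gap_sum_ge[OF h] learning_super super) (simp add: bd learning_boundary)
    have "(\<Sum>y\<in>V. L f (Suc k * n) y - h y) \<le> (\<Sum>y\<in>V. midrange G ?g y - h y)"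
      unfolding n_def using learning_round[OF super] by (intro sum_mono) (simp del: mult_Suc)
    also have "\<dots> = (\<Sum>y\<in>V. ?g y - h y) - (\<Sum>y\<in>V. ?g y - midrange G ?g y)"
      by (simp add: sum_subtractf)
    \<comment> \<open>By \<open>gap\<close>, the subtracted sum is at least the fraction
      \<open>1 / (2 * n^2)\<close> of the total excess.\<close>
    also have "\<dots> \<le> q * (\<Sum>y\<in>V. ?g y - h y)"
      using gap n by (simp add: q_def n_def[symmetric] field_simps)
    also have "\<dots> \<le> q * (q ^ k * (\<Sum>y\<in>V. f y - h y))"
      using Suc q by (intro mult_left_mono)
    finally show ?case by simp
  qed simp
  \<comment> \<open>The updates of an unfinished last round can only decrease the sum.\<close>
  have "(\<Sum>y\<in>V. L f t y - h y) \<le> (\<Sum>y\<in>V. L f (t div n * n) y - h y)"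
    by (intro sum_mono diff_right_mono learning_decreasing[OF super]) simp
  then show ?thesis using rounds[of "t div n"] unfolding n_def by linarith
qed

lemma l1_rate:
  assumes f: "\<And>x. x \<in> V \<union> B \<Longrightarrow> f x \<in> {0..1}"
    and ext: "infinity_harmonic_extension G B V f h"
  defines "n \<equiv> card V"
  shows "l1_norm G (\<lambda>x. L f t x - h x) \<le> real n * (1 - 1 / (2 * real n ^ 2)) ^ (t div n)"
proof -
  define q where "q = (1 - 1 / (2 * real n ^ 2)) ^ (t div n)"
  have h: "infinity_harmonic_on G V h" and hB: "\<And>b. b \<in> B \<Longrightarrow> h b = f b"
    using ext by (auto simp: infinity_harmonic_extension_def)
  note h' = harmonic_uminus[OF h]
  have h01: "h x \<in> {0..1}" if "x \<in> V" for x
    using harmonic_attains_below[OF h that] harmonic_attains_below[OF h' that] hB f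
    by fastforce
  define u where "u x = (if x \<in> V then 1 else f x)" for x
  \<comment> \<open>\<open>l\<close> is the negated lower barrier: a supersolution to be compared
    with \<open>-h\<close>, just as \<open>u\<close> is compared with \<open>h\<close>.\<close>
  define l where "l x = (if x \<in> V then 0 else - f x)" for x
  have uB: "u b = f b" and lB: "l b = - f b" if "b \<in> B" for b
    using that disjoint by (auto simp: u_def l_def)
  have "midrange G u x \<le> 1" if "x \<in> V" for x
    using midrange_mono[OF that, of u "\<lambda>_. 1"] midrange_const[OF that] nbrs_subset[of x] f
    by (force simp: u_def)
  then have super_u: "supersolution u" by (simp add: supersolution_def u_def)
  have "midrange G l x \<le> 0" if "x \<in> V" for x
    using midrange_mono[OF that, of l "\<lambda>_. 0"] midrange_const[OF that] nbrs_subset[of x] f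
    by (force simp: l_def)
  then have super_l: "supersolution l" by (simp add: supersolution_def l_def)
  have up: "L f t x \<le> L u t x" and lo: "- L f t x \<le> L l t x"
    and hu: "h x \<le> L u t x" and hl: "- h x \<le> L l t x" if "x \<in> V" for x
  proof -
    have x: "x \<in> V \<union> B" using that by simp
    show "L f t x \<le> L u t x"
      using f by (intro learning_mono[OF _ x]) (auto simp: u_def)
    show "- L f t x \<le> L l t x"
      using learning_mono[of "\<lambda>x. - f x" l x t] x f by (auto simp: l_def learning_uminus)
    show "h x \<le> L u t x"
      using h01 hB uB by (intro learning_ge_harmonic[OF h _ x]) (auto simp: u_def)
    show "- h x \<le> L l t x"
      using h01 hB lB by (intro learning_ge_harmonic[OF h' _ x]) (auto simp: l_def)
  qed
  have "l1_norm G (\<lambda>x. L f t x - h x) = (\<Sum>x\<in>V. \<bar>L f t x - h x\<bar>)"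
    unfolding l1_norm_def pverts_eq using finite_V finite_B disjoint
    by (simp add: sum.union_disjoint hB learning_boundary)
  \<comment> \<open>Both distances to \<open>h\<close> are nonnegative, and each bounds one sign of
    the error.\<close>
  also have "\<dots> \<le> (\<Sum>x\<in>V. (L u t x - h x) + (L l t x - (- h x)))"
    using up lo hu hl by (intro sum_mono) (smt (verit))
  also have "\<dots> = (\<Sum>x\<in>V. L u t x - h x) + (\<Sum>x\<in>V. L l t x - (- h x))"
    by (rule sum.distrib)
  also have "\<dots> \<le> q * (\<Sum>x\<in>V. u x - h x) + q * (\<Sum>x\<in>V. l x - (- h x))"
    unfolding q_def n_def
    using h01 hB uB lB
    by (intro add_mono supersolution_rate h h' super_u super_l) (auto simp: u_def l_def)
  also have "\<dots> = q * (\<Sum>x\<in>V. (u x - h x) + (l x - (- h x)))"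
    by (simp only: sum.distrib distrib_left)
  also have "(\<Sum>x\<in>V. (u x - h x) + (l x - (- h x))) = (\<Sum>x\<in>V. 1)"
    by (intro sum.cong) (auto simp: u_def l_def)
  finally show ?thesis by (simp add: q_def n_def mult.commute)
qed

end

section \<open>Exponential form of the rate and the bound on the hitting time\<close>

lemma sup_norm_le_l1_norm:
  assumes "finite (pverts G)" "pverts G \<noteq> {}"
  shows "sup_norm G f \<le> l1_norm G f"
  using assms by (auto simp: sup_norm_def l1_norm_def intro: member_le_sum)

theorem proposition1p8:
  fixes G :: "'a pair_pre_digraph" and B V :: "'a set" and n :: nat
    and f0 h :: "'a \<Rightarrow> real" and v :: "nat \<Rightarrow> 'a" and f :: "nat \<Rightarrow> 'a \<Rightarrow> real"
  assumes "graph_with_boundary G B V"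
    and "card V = n"
    and "\<forall>x\<in>V \<union> B. f0 x \<in> {0..1}"
    and "infinity_harmonic_extension G B V f0 h"
    and "round_robin V v"
    and "f = lipschitz_learning G v f0"
  shows "(\<forall>t. l1_norm G (\<lambda>x. f t x - h x)
              \<le> real n * exp (- real_of_int \<lfloor>real t / real n\<rfloor> / (2 * real n ^ 2))) \<and>
         (\<forall>\<epsilon>::real. 0 < \<epsilon> \<and> \<epsilon> < 1 \<longrightarrow>
              ereal_of_enat (tau_star G f h \<epsilon>)
              \<le> ereal (real n + 2 * real n ^ 3 * ln (real n / \<epsilon>)))"
proof -
  interpret learning G B V v
    using assms by unfold_locales auto
  have n: "1 \<le> n"
    using finite_V V_ne assms(2) by (auto simp: Suc_le_eq card_gt_0_iff)
  have l1: "l1_norm G (\<lambda>x. f t x - h x)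
      \<le> real n * exp (- real_of_int \<lfloor>real t / real n\<rfloor> / (2 * real n ^ 2))" for t
  proof -
    define y where "y = 1 / (2 * real n ^ 2)"
    have "1 \<le> real n ^ 2" using n by simp
    then have "y \<le> 1 / 1" unfolding y_def by (intro frac_le) linarith+
    then have y: "0 \<le> 1 - y" by simp
    have "(1 - y) ^ (t div n) \<le> exp (- y) ^ (t div n)"
      using exp_ge_add_one_self[of "- y"] y by (intro power_mono) auto
    also have "\<dots> = exp (- real_of_int \<lfloor>real t / real n\<rfloor> / (2 * real n ^ 2))"
      by (simp add: exp_of_nat_mult[symmetric] floor_divide_of_nat_eq y_def)
    finally have "real n * (1 - y) ^ (t div n)
        \<le> real n * exp (- real_of_int \<lfloor>real t / real n\<rfloor> / (2 * real n ^ 2))"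
      by (intro mult_left_mono) auto
    then show ?thesis
      using l1_rate[of f0 h t] assms by (simp add: y_def)
  qed
  moreover have "ereal_of_enat (tau_star G f h \<epsilon>)
      \<le> ereal (real n + 2 * real n ^ 3 * ln (real n / \<epsilon>))" if \<epsilon>: "0 < \<epsilon>" "\<epsilon> < 1" for \<epsilon>
  proof -
    \<comment> \<open>\<open>a\<close> is the real number of rounds after which
      \<open>n * exp (- a / (2 * n^2))\<close> equals \<open>\<epsilon>\<close>. Rounding up costs
      at most one round, which is the additive \<open>n\<close> in the bound.\<close>
    define a where "a = 2 * real n ^ 2 * ln (real n / \<epsilon>)"
    have "1 \<le> real n / \<epsilon>" using n \<epsilon> by (simp add: field_simps)
    then have a0: "0 \<le> a" by (simp add: a_def)
    define k where "k = nat \<lceil>a\<rceil>"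
    have k: "a \<le> real k" "real k \<le> a + 1" using a0 by (auto simp: k_def)
    have "sup_norm G (\<lambda>x. f (k * n) x - h x) \<le> l1_norm G (\<lambda>x. f (k * n) x - h x)"
      using finite_V finite_B V_ne by (intro sup_norm_le_l1_norm) (auto simp: pverts_eq)
    also have "\<dots> \<le> real n * exp (- real k / (2 * real n ^ 2))"
      using l1[of "k * n"] n by simp
    also have "\<dots> \<le> real n * exp (- ln (real n / \<epsilon>))"
      using k(1) n by (intro mult_left_mono) (auto simp: a_def field_simps)
    also have "\<dots> = \<epsilon>"
      using n \<epsilon> by (simp add: exp_minus field_simps)
    finally have "tau_star G f h \<epsilon> \<le> enat (k * n)"
      unfolding tau_star_def by (intro INF_lower) simp
    then have "ereal_of_enat (tau_star G f h \<epsilon>) \<le> ereal_of_enat (enat (k * n))"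
      by (simp only: ereal_of_enat_le_iff)
    also have "\<dots> = ereal (real k * real n)" by simp
    also have "\<dots> \<le> ereal ((a + 1) * real n)"
      using k(2) by (simp add: mult_right_mono)
    also have "(a + 1) * real n = real n + 2 * real n ^ 3 * ln (real n / \<epsilon>)"
      by (simp add: a_def algebra_simps power2_eq_square power3_eq_cube)
    finally show ?thesis .
  qed
  ultimately show ?thesis by blast
qed

end
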